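(* Every nontrivial abelian group $G$ has a proper essential extension.
   Context: A normal subgroup $E$ of a group $K$ is called an essential subgroup of $K$ if every nontrivial normal subgroup of $K$ intersects $E$ nontrivially. A group $G$ has an essential extension if there exist a group $\overline{G}$ (not necessarily abelian) and a monomorphism $\varphi: G \rightarrow \overline{G}$ such that $\varphi(G)$ is an essential subgroup of $\overline{G}$; if $\varphi(G) \neq \overline{G}$, the essential extension is said to be proper. *)

theory Defs
  imports "HOL-Algebra.Elementary_Groups"
begin

definition essential_subgroup :: "'a set \<Rightarrow> ('a, 'm) monoid_scheme \<Rightarrow> bool" where
  "essential_subgroup E K \<longleftrightarrow>
     E \<lhd> K \<and> (\<forall>N. N \<lhd> K \<and> N \<noteq> {\<one>\<^bsub>K\<^esub>} \<longrightarrow> N \<inter> E \<noteq> {\<one>\<^bsub>K\<^esub>})"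

definition essential_extension ::
    "('a, 'm) monoid_scheme \<Rightarrow> ('b, 'n) monoid_scheme \<Rightarrow> ('a \<Rightarrow> 'b) \<Rightarrow> bool" where
  "essential_extension G K \<phi> \<longleftrightarrow>
     group G \<and> group K \<and> \<phi> \<in> mon G K \<and> essential_subgroup (\<phi> ` carrier G) K"

definition proper_essential_extension ::
    "('a, 'm) monoid_scheme \<Rightarrow> ('b, 'n) monoid_scheme \<Rightarrow> ('a \<Rightarrow> 'b) \<Rightarrow> bool" where
  "proper_essential_extension G K \<phi> \<longleftrightarrow>
     essential_extension G K \<phi> \<and> \<phi> ` carrier G \<noteq> carrier K"

text \<open>
  Existence of an extension group ranges over all groups, but HOL has no quantifier over types,
  so the element type of the extension has to be named. The type \<^typ>\<open>'a \<times> nat\<close> carries a copy of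
  every group of cardinality at most the maximum of the cardinalities of \<^typ>\<open>'a\<close> and \<^typ>\<open>nat\<close>;
  since the carrier may be any subset, this includes all finite groups. An extension on this type
  is in particular an extension.
\<close>

definition has_proper_essential_extension :: "('a, 'm) monoid_scheme \<Rightarrow> bool" where
  "has_proper_essential_extension G \<longleftrightarrow>
     (\<exists>(K :: ('a \<times> nat) monoid) \<phi>. proper_essential_extension G K \<phi>)"

end

theory Submission
  imports Defs
begin

text \<open>
  Let \<open>a \<in> G\<close> satisfy \<open>a\<^sup>2 = 1\<close>, and let \<open>K\<close> be the generalized dicyclic group generated by \<open>G\<close> and
  an element \<open>s\<close> that inverts \<open>G\<close> and has \<open>s\<^sup>2 = a\<close>. Every element of \<open>K\<close> outside \<open>G\<close> has square \<open>a\<close>,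
  and its commutator with \<open>h \<in> G\<close> is \<open>h\<^sup>2\<close>. A normal subgroup of \<open>K\<close> not contained in \<open>G\<close> therefore
  contains \<open>a\<close> and all squares of \<open>G\<close>, so \<open>G\<close> is essential in \<open>K\<close> unless both \<open>a = 1\<close> and \<open>G\<close> has
  exponent dividing 2. If \<open>G\<close> has an element whose square is not 1, take \<open>a = 1\<close>, otherwise
  take any \<open>a \<noteq> 1\<close>.
\<close>

text \<open>The pair \<open>(g, i)\<close> stands for \<open>g s\<^sup>i\<close>.\<close>

definition dicyclic_extension :: "('a, 'm) monoid_scheme \<Rightarrow> 'a \<Rightarrow> ('a \<times> nat) monoid" where
  "dicyclic_extension G a =
     \<lparr>carrier = carrier G \<times> {0, 1},
      mult = (\<lambda>(g, i) (h, j).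
        (g \<otimes>\<^bsub>G\<^esub> (if i = 0 then h else inv\<^bsub>G\<^esub> h) \<otimes>\<^bsub>G\<^esub> (if i = 1 \<and> j = 1 then a else \<one>\<^bsub>G\<^esub>),
         (i + j) mod 2)),
      one = (\<one>\<^bsub>G\<^esub>, 0)\<rparr>"

context comm_group
begin

text \<open>\<open>s\<close> commutes with its square \<open>a\<close> and also inverts it, which
  forces \<open>a\<close> to be its own inverse. Associativity uses this when all three factors lie
  outside \<open>G\<close>.\<close>

lemma group_dicyclic_extension:
  assumes a: "a \<in> carrier G" and aa: "a \<otimes> a = \<one>"
  shows "group (dicyclic_extension G a)"
proof -
  have inv_a: "inv a = a"
    using a aa inv_equality by blast
  let ?K = "dicyclic_extension G a"
  show ?thesis
  proof (rule groupI)
    fix x y assume "x \<in> carrier ?K" "y \<in> carrier ?K"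
    then show "x \<otimes>\<^bsub>?K\<^esub> y \<in> carrier ?K"
      using a by (auto simp: dicyclic_extension_def)
  next
    show "\<one>\<^bsub>?K\<^esub> \<in> carrier ?K"
      by (simp add: dicyclic_extension_def)
  next
    fix x y z assume "x \<in> carrier ?K" "y \<in> carrier ?K" "z \<in> carrier ?K"
    then obtain g i h j k l where x: "x = (g, i)" and y: "y = (h, j)" and z: "z = (k, l)"
      and mem: "g \<in> carrier G" "h \<in> carrier G" "k \<in> carrier G"
      and "i = 0 \<or> i = 1" "j = 0 \<or> j = 1" "l = 0 \<or> l = 1"
      by (auto simp: dicyclic_extension_def)
    then show "x \<otimes>\<^bsub>?K\<^esub> y \<otimes>\<^bsub>?K\<^esub> z = x \<otimes>\<^bsub>?K\<^esub> (y \<otimes>\<^bsub>?K\<^esub> z)"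
      using a inv_a
      by (elim disjE) (simp_all add: dicyclic_extension_def m_ac inv_mult)
  next
    fix x assume "x \<in> carrier ?K"
    then show "\<one>\<^bsub>?K\<^esub> \<otimes>\<^bsub>?K\<^esub> x = x"
      by (auto simp: dicyclic_extension_def)
  next
    fix x assume "x \<in> carrier (?K)"
    then obtain g i where x: "x = (g, i)" "g \<in> carrier G" "i = 0 \<or> i = 1"
      by (auto simp: dicyclic_extension_def)
    \<comment> \<open>An element outside \<open>G\<close> has square \<open>a\<close>, so its
      inverse is its product with \<open>a\<close>.\<close>
    let ?y = "(if i = 0 then inv g else g \<otimes> a, i)"
    have "?y \<in> carrier (?K)"
      using x a by (auto simp: dicyclic_extension_def)
    moreover have "?y \<otimes>\<^bsub>?K\<^esub> x = \<one>\<^bsub>?K\<^esub>"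
      using x a aa by (auto simp: dicyclic_extension_def m_ac)
    ultimately show "\<exists>y\<in>carrier (?K).
        y \<otimes>\<^bsub>?K\<^esub> x = \<one>\<^bsub>?K\<^esub>"
      by blast
  qed
qed

lemma mon_dicyclic_extension: "(\<lambda>g. (g, 0)) \<in> mon G (dicyclic_extension G a)"
  by (auto simp: mon_def hom_def inj_on_def dicyclic_extension_def)

text \<open>Were \<open>nontriv\<close> false, \<open>?K\<close> would be the direct product of
  \<open>G\<close> and the group generated by \<open>s\<close>, a normal subgroup meeting
  \<open>?E\<close> trivially.\<close>

lemma essential_subgroup_dicyclic_extension:
  assumes a: "a \<in> carrier G" and aa: "a \<otimes> a = \<one>"
    and nontriv: "a \<noteq> \<one> \<or> (\<exists>h\<in>carrier G. h \<otimes> h \<noteq> \<one>)"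
  shows "essential_subgroup ((\<lambda>g. (g, 0)) ` carrier G) (dicyclic_extension G a)"
    (is "essential_subgroup ?E ?K")
proof -
  interpret K: group ?K
    using a aa by (rule group_dicyclic_extension)
  \<comment> \<open>Not interpreted: its simp rules fold \<open>(g \<otimes> h, 0)\<close> and loop with the definition of \<open>K\<close>.\<close>
  have \<phi>: "group_hom G ?K (\<lambda>g. (g, 0))"
    using mon_dicyclic_extension by unfold_locales (auto simp: mon_def)
  have E_normal: "?E \<lhd> ?K"
  proof (rule K.normal_invI)
    show "subgroup ?E ?K"
      by (rule group_hom.img_is_subgroup[OF \<phi>])
  next
    fix x e assume x: "x \<in> carrier ?K" and e: "e \<in> ?E"
    \<comment> \<open>Modulo 2, \<open>snd\<close> is a homomorphism with kernel
      \<open>?E\<close>.\<close>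
    have snd_mult: "snd (y \<otimes>\<^bsub>?K\<^esub> z) = (snd y + snd z) mod 2" for y z
      by (cases y, cases z) (simp add: dicyclic_extension_def)
    have snd_one: "snd \<one>\<^bsub>?K\<^esub> = 0"
      by (simp add: dicyclic_extension_def)
    have e_carrier: "e \<in> carrier ?K" and "snd e = 0"
      using e by (auto simp: dicyclic_extension_def)
    from \<open>snd e = 0\<close> have "snd (x \<otimes>\<^bsub>?K\<^esub> e \<otimes>\<^bsub>?K\<^esub> inv\<^bsub>?K\<^esub> x) = (snd x + snd (inv\<^bsub>?K\<^esub> x)) mod 2"
      unfolding snd_mult by presburger
    also have "\<dots> = 0"
      unfolding snd_mult[symmetric] K.r_inv[OF x] snd_one ..
    finally have "snd (x \<otimes>\<^bsub>?K\<^esub> e \<otimes>\<^bsub>?K\<^esub> inv\<^bsub>?K\<^esub> x) = 0" .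
    moreover have "x \<otimes>\<^bsub>?K\<^esub> e \<otimes>\<^bsub>?K\<^esub> inv\<^bsub>?K\<^esub> x \<in> carrier ?K"
      using x e_carrier by simp
    ultimately show "x \<otimes>\<^bsub>?K\<^esub> e \<otimes>\<^bsub>?K\<^esub> inv\<^bsub>?K\<^esub> x \<in> ?E"
      by (auto simp: dicyclic_extension_def)
  qed
  moreover have "N \<inter> ?E \<noteq> {\<one>\<^bsub>?K\<^esub>}" if N: "N \<lhd> ?K" and "N \<noteq> {\<one>\<^bsub>?K\<^esub>}" for N
  proof (cases "N \<subseteq> ?E")
    case True
    then show ?thesis
      using that(2) by (simp add: Int_absorb2)
  next
    case False
    interpret N: normal N ?K by (rule N)
    obtain g i where gi: "(g, i) \<in> N" "(g, i) \<notin> ?E"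
      using False by auto
    from N.subset gi(1) have "(g, i) \<in> carrier ?K" ..
    with gi(2) have g: "g \<in> carrier G" and "i = 1"
      by (auto simp: dicyclic_extension_def)
    with gi(1) have gN: "(g, 1) \<in> N"
      by simp
    have sq: "(a, 0) \<in> N"
      using N.m_closed[OF gN gN] g a by (simp add: dicyclic_extension_def)
    have comm: "(h \<otimes> h, 0) \<in> N" if h: "h \<in> carrier G" for h
    proof -
      have conj: "(h, 0) \<otimes>\<^bsub>?K\<^esub> (g, 1) \<otimes>\<^bsub>?K\<^esub> inv\<^bsub>?K\<^esub> (h, 0) \<in> N"
        using h by (intro N.inv_op_closed2 gN) (simp add: dicyclic_extension_def)
      have "inv\<^bsub>?K\<^esub> (h, 0) = (inv h, 0)"
        using group_hom.hom_inv[OF \<phi> h] by simp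
      then have "(h \<otimes> g \<otimes> h, 1) \<in> N"
        using conj g h by (simp add: dicyclic_extension_def)
      \<comment> \<open>This is the inverse of \<open>(g, 1)\<close>; multiplying the conjugate by
        it gives the commutator.\<close>
      moreover have "(g \<otimes> a, 1) \<in> N"
        using N.m_closed[OF sq gN] g a by (simp add: dicyclic_extension_def m_comm)
      ultimately have "(h \<otimes> g \<otimes> h, 1) \<otimes>\<^bsub>?K\<^esub> (g \<otimes> a, 1) \<in> N"
        by simp
      moreover have "h \<otimes> g \<otimes> h \<otimes> inv (g \<otimes> a) \<otimes> a = h \<otimes> h"
      proof -
        \<comment> \<open>With the inverse generalized to \<open>t\<close>, this is mere regrouping;
          \<open>g \<otimes> a\<close> then cancels.\<close>
        have "h \<otimes> g \<otimes> h \<otimes> t \<otimes> a = (h \<otimes> h) \<otimes> ((g \<otimes> a) \<otimes> t)" if "t \<in> carrier G" for t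
          using g h a that by (simp add: m_ac)
        from this[of "inv (g \<otimes> a)"] show ?thesis
          using g h a by (simp only: inv_closed m_closed r_inv r_one)
      qed
      ultimately show ?thesis
        by (simp add: dicyclic_extension_def)
    qed
    obtain b where "b \<in> carrier G" "b \<noteq> \<one>" "(b, 0) \<in> N"
      using nontriv a sq comm by blast
    then show ?thesis
      by (auto simp: dicyclic_extension_def)
  qed
  ultimately show ?thesis
    by (simp add: essential_subgroup_def)
qed

end

theorem corollary3p3:
  fixes G :: "('a, 'm) monoid_scheme"
  assumes "comm_group G"
    and "carrier G \<noteq> {\<one>\<^bsub>G\<^esub>}"
  shows "has_proper_essential_extension G"
proof -
  interpret comm_group G by (rule assms(1))
  obtain a where a: "a \<in> carrier G" "a \<otimes>\<^bsub>G\<^esub> a = \<one>\<^bsub>G\<^esub>"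
    and nontriv: "a \<noteq> \<one>\<^bsub>G\<^esub> \<or> (\<exists>h\<in>carrier G. h \<otimes>\<^bsub>G\<^esub> h \<noteq> \<one>\<^bsub>G\<^esub>)"
  proof (cases "\<exists>h\<in>carrier G. h \<otimes>\<^bsub>G\<^esub> h \<noteq> \<one>\<^bsub>G\<^esub>")
    case True
    then show ?thesis
      using that[of "\<one>\<^bsub>G\<^esub>"] by simp
  next
    case False
    obtain b where "b \<in> carrier G" "b \<noteq> \<one>\<^bsub>G\<^esub>"
      using assms(2) one_closed by blast
    with False that[of b] show ?thesis
      by blast
  qed
  have "essential_extension G (dicyclic_extension G a) (\<lambda>g. (g, 0))"
    using group_dicyclic_extension[OF a] mon_dicyclic_extension
      essential_subgroup_dicyclic_extension[OF a nontriv]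
    by (simp add: essential_extension_def)
  \<comment> \<open>The element \<open>s\<close> itself witnesses properness.\<close>
  moreover have "(\<one>\<^bsub>G\<^esub>, 1) \<in> carrier (dicyclic_extension G a) - (\<lambda>g. (g, 0)) ` carrier G"
    by (auto simp: dicyclic_extension_def)
  ultimately show ?thesis
    unfolding has_proper_essential_extension_def proper_essential_extension_def by blast
qed

end
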